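(* Let $s\ge1$ and $n\ge1$ be integers, let $p,q\in(0,1)$ satisfy $\sum_{k=0}^{s}p^kq^{s-k}=1$, and let $X\sim\mathcal{B}^{(s)}(n,p)$ follow the bi$^s$nomial distribution. Let $r\ge1$ be an integer. Then the moment of order $r$, $M(r)=E(X^r)$, is given by $$M(r)=\sum_{k=1}^{r}(n)_k\,B_{r,k}\Big(\sum_{l=1}^{s}l\,p^lq^{s-l},\ \sum_{l=1}^{s}l^2p^lq^{s-l},\ \ldots,\ \sum_{l=1}^{s}l^{r-k+1}p^lq^{s-l}\Big)\quad\text{if }p\neq q,$$ and $$M(r)=\sum_{k=1}^{r}(n)_k\,p^{ks}\,B_{r,k}\Big(\sum_{l=1}^{s}l,\ \sum_{l=1}^{s}l^2,\ \ldots,\ \sum_{l=1}^{s}l^{r-k+1}\Big)\quad\text{if }p=q,$$ where $(n)_k=n(n-1)\cdots(n-k+1)$ is the falling factorial.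
   Context: For integers $n\ge 1$, $s\ge1$, $k\ge0$, the bi$^s$nomial coefficient $\binom{n}{k}_s$ is the number of integer solutions $(x_1,\dots,x_n)$ of $x_1+\cdots+x_n=k$ with $0\le x_i\le s$ for all $i$; equivalently, the coefficient of $x^k$ in $(1+x+\cdots+x^s)^n$. The bi$^s$nomial distribution $\mathcal{B}^{(s)}(n,p)$, where $p,q\in(0,1)$ satisfy $\sum_{k=0}^s p^kq^{s-k}=1$, is the law on $\{0,\dots,sn\}$ with $\mathbb{P}(X=k)=\binom{n}{k}_s p^kq^{sn-k}$. The partial Bell polynomials are $$B_{r,k}(x_1,x_2,\ldots,x_{r-k+1})=\sum\frac{r!}{j_1!j_2!\cdots}\Big(\frac{x_1}{1!}\Big)^{j_1}\Big(\frac{x_2}{2!}\Big)^{j_2}\cdots,$$ the sum being over nonnegative integers $j_1,j_2,\ldots$ with $j_1+j_2+\cdots=k$ and $j_1+2j_2+3j_3+\cdots=r$; equivalently $\sum_{r\ge k}B_{r,k}(x_1,x_2,\ldots)\frac{t^r}{r!}=\frac1{k!}\big(\sum_{m\ge1}x_m\frac{t^m}{m!}\big)^k$. *)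

theory Defs
  imports "HOL-Probability.Probability"
begin

definition bisnomial :: "nat \<Rightarrow> nat \<Rightarrow> nat \<Rightarrow> nat" where
  "bisnomial s n k = card {x \<in> {1..n} \<rightarrow>\<^sub>E {0..s}. (\<Sum>i=1..n. x i) = k}"

definition bisnomial_mass :: "nat \<Rightarrow> nat \<Rightarrow> real \<Rightarrow> real \<Rightarrow> nat \<Rightarrow> real" where
  "bisnomial_mass s n p q k =
     (if k \<le> s * n then real (bisnomial s n k) * p ^ k * q ^ (s * n - k) else 0)"

(* For k <= r the constraints give (SUM i. (i - 1) * j i) = r - k, so j i = 0 for all i > r - k + 1;
   hence the index set {1..r - k + 1} loses no sequence j. For k > r the index set is {1},
   no j satisfies both constraints, and the value is 0. *)
definition partial_bell :: "nat \<Rightarrow> nat \<Rightarrow> (nat \<Rightarrow> real) \<Rightarrow> real" where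
  "partial_bell r k x =
     (\<Sum>j \<in> {j \<in> {1..r - k + 1} \<rightarrow>\<^sub>E (UNIV :: nat set).
               (\<Sum>i=1..r - k + 1. j i) = k \<and> (\<Sum>i=1..r - k + 1. i * j i) = r}.
        fact r / (\<Prod>i=1..r - k + 1. fact (j i)) * (\<Prod>i=1..r - k + 1. (x i / fact i) ^ j i))"

definition falling_factorial :: "nat \<Rightarrow> nat \<Rightarrow> real" where
  "falling_factorial n k = (\<Prod>i<k. real n - real i)"

end

theory Submission
  imports Defs
begin

(* Put G(t) = (SUM m >= 1. mu_m t^m / m!) with mu_m = (SUM l. l^m p^l q^(s - l)). Since the weights
   p^l q^(s - l) sum to 1, the exponential generating function of the moments of X is
   (SUM l = 0..s. p^l q^(s - l) e^(l t))^n = (1 + G(t))^n = (SUM k. (n)_k G(t)^k / k!),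
   and r! [t^r] G(t)^k / k! is the Bell polynomial B_{r,k}(mu_1, mu_2, ...) by the multinomial theorem.
   For p = q the weights are all p^s, which comes out as p^(k s) because B_{r,k} is homogeneous of degree k. *)

unbundle no vec_syntax and fps_syntax

section \<open>The multinomial theorem for formal power series\<close>

lemma finite_PiE_sum_eq:
  fixes k :: nat
  assumes "finite A"
  shows "finite {j \<in> A \<rightarrow>\<^sub>E UNIV. sum j A = k}"
proof (rule finite_subset)
  show "{j \<in> A \<rightarrow>\<^sub>E UNIV. sum j A = k} \<subseteq> A \<rightarrow>\<^sub>E {..k}"
    using assms by (auto simp: PiE_iff member_le_sum extensional_def)
  show "finite (A \<rightarrow>\<^sub>E {..k})"
    using assms by (intro finite_PiE) auto
qed

text \<open>Splitting off the value \<open>m\<close> at the new point leaves a function on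
  \<open>A\<close> with sum \<open>k - m\<close>. This supplies the induction step of the
  multinomial theorem.\<close>

lemma sum_PiE_insert_sum_eq:
  fixes k :: nat and F :: "('a \<Rightarrow> nat) \<Rightarrow> 'b :: comm_monoid_add"
  assumes "finite A" "x \<notin> A"
  shows "(\<Sum>j | j \<in> insert x A \<rightarrow>\<^sub>E UNIV \<and> sum j (insert x A) = k. F j) =
         (\<Sum>m\<le>k. \<Sum>j | j \<in> A \<rightarrow>\<^sub>E UNIV \<and> sum j A = k - m. F (j(x := m)))"
proof -
  have sum_upd: "(\<Sum>i\<in>A. if i = x then m else j i) = sum j A" for j :: "'a \<Rightarrow> nat" and m
    using assms by (intro sum.cong) auto
  have "(\<Sum>m\<le>k. \<Sum>j | j \<in> A \<rightarrow>\<^sub>E UNIV \<and> sum j A = k - m. F (j(x := m))) =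
        (\<Sum>(m, j) \<in> (SIGMA m:{..k}. {j. j \<in> A \<rightarrow>\<^sub>E UNIV \<and> sum j A = k - m}). F (j(x := m)))"
    using finite_PiE_sum_eq[OF assms(1)] by (subst sum.Sigma) auto
  also have "\<dots> = (\<Sum>j | j \<in> insert x A \<rightarrow>\<^sub>E UNIV \<and> sum j (insert x A) = k. F j)"
    \<comment> \<open>Resetting the value at \<open>x\<close> to \<open>undefined\<close> makes the
      function extensional on \<open>A\<close>, because \<open>x\<close> lies outside
      \<open>A\<close>.\<close>
    by (rule sum.reindex_bij_witness[where i = "\<lambda>j. (j x, j(x := undefined))"
          and j = "\<lambda>(m, j). j(x := m)"])
      (use assms in \<open>auto simp: sum_upd PiE_iff extensional_def fun_eq_iff\<close>)
  finally show ?thesis ..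
qed

text \<open>Induction on \<open>A\<close> with the binomial theorem. Dividing by
  \<open>fact k\<close> turns the multinomial coefficient into a product of factors
  \<open>1 / fact (j i)\<close>, one for each index, so it splits along with the sum.\<close>

lemma fps_multinomial:
  fixes a :: "'a \<Rightarrow> 'b :: field_char_0 fps"
  assumes "finite A"
  shows "fps_const (1 / fact k) * (\<Sum>i\<in>A. a i) ^ k =
         (\<Sum>j | j \<in> A \<rightarrow>\<^sub>E UNIV \<and> sum j A = k. \<Prod>i\<in>A. fps_const (1 / fact (j i)) * a i ^ j i)"
  using assms
proof (induction A arbitrary: k rule: finite_induct)
  case empty
  have "{j \<in> {} \<rightarrow>\<^sub>E (UNIV :: nat set). sum j ({} :: 'a set) = k} = (if k = 0 then {\<lambda>_. undefined} else {})"
    by auto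
  then show ?case by (cases k) auto
next
  case (insert x A)
  define T where "T m k = fps_const (1 / fact m) * a x ^ m * (fps_const (1 / fact k) * (\<Sum>i\<in>A. a i) ^ k)" for m k
  have "fps_const (1 / fact k) * (\<Sum>i\<in>insert x A. a i) ^ k =
        (\<Sum>m\<le>k. fps_const (1 / fact k) * (of_nat (k choose m) * a x ^ m * (\<Sum>i\<in>A. a i) ^ (k - m)))"
    using insert.hyps by (simp add: binomial_ring sum_distrib_left)
  also have "\<dots> = (\<Sum>m\<le>k. T m (k - m))"
  proof (rule sum.cong)
    fix m assume "m \<in> {..k}"
    then have coeff: "fps_const (1 / fact k) * of_nat (k choose m) =
               fps_const (1 / fact m) * (fps_const (1 / fact (k - m)) :: 'b fps)"
      by (simp add: binomial_fact flip: fps_of_nat)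
    have "fps_const (1 / fact k) * (of_nat (k choose m) * a x ^ m * (\<Sum>i\<in>A. a i) ^ (k - m)) =
          (fps_const (1 / fact k) * of_nat (k choose m)) * a x ^ m * (\<Sum>i\<in>A. a i) ^ (k - m)"
      by (simp only: mult.assoc)
    then show "fps_const (1 / fact k) * (of_nat (k choose m) * a x ^ m * (\<Sum>i\<in>A. a i) ^ (k - m)) = T m (k - m)"
      unfolding T_def coeff by (simp only: mult_ac)
  qed simp
  also have "\<dots> = (\<Sum>m\<le>k. \<Sum>j | j \<in> A \<rightarrow>\<^sub>E UNIV \<and> sum j A = k - m.
                    fps_const (1 / fact m) * a x ^ m * (\<Prod>i\<in>A. fps_const (1 / fact (j i)) * a i ^ j i))"
    unfolding T_def insert.IH by (simp add: sum_distrib_left)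
  also have "\<dots> = (\<Sum>m\<le>k. \<Sum>j | j \<in> A \<rightarrow>\<^sub>E UNIV \<and> sum j A = k - m.
                    \<Prod>i\<in>insert x A. fps_const (1 / fact ((j(x := m)) i)) * a i ^ (j(x := m)) i)"
  proof (intro sum.cong refl)
    fix m j
    have "(\<Prod>i\<in>A. fps_const (1 / fact (j i)) * a i ^ j i) =
          (\<Prod>i\<in>A. fps_const (1 / fact ((j(x := m)) i)) * a i ^ (j(x := m)) i)"
      using insert.hyps by (intro prod.cong) auto
    then show "fps_const (1 / fact m) * a x ^ m * (\<Prod>i\<in>A. fps_const (1 / fact (j i)) * a i ^ j i) =
      (\<Prod>i\<in>insert x A. fps_const (1 / fact ((j(x := m)) i)) * a i ^ (j(x := m)) i)"
      using insert.hyps by simp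
  qed
  finally show ?case
    using insert.hyps by (subst sum_PiE_insert_sum_eq) auto
qed

section \<open>Bell polynomials as coefficients of powers of a series\<close>

lemma fps_power_nth_cong:
  fixes f g :: "'a :: comm_semiring_1 fps"
  assumes "\<And>i. i \<le> m \<Longrightarrow> f $ i = g $ i" "i \<le> m"
  shows "(f ^ k) $ i = (g ^ k) $ i"
  using assms(2)
proof (induction k arbitrary: i)
  case (Suc k)
  then show ?case by (simp add: fps_mult_nth assms(1))
qed simp

text \<open>Each term of the multinomial expansion is a single monomial; its exponent is the
  weighted sum that the second constraint in \<open>partial_bell\<close> fixes.\<close>

lemma fps_prod_const_X_power:
  fixes c :: "nat \<Rightarrow> 'a :: comm_ring_1"
  shows "(\<Prod>i\<in>A. fps_const (b i) * (fps_const (c i) * fps_X ^ i) ^ j i) =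
         fps_const (\<Prod>i\<in>A. b i * c i ^ j i) * fps_X ^ (\<Sum>i\<in>A. i * j i)"
  by (induction A rule: infinite_finite_induct)
    (auto simp: power_mult_distrib power_add fps_const_power mult_ac
      simp flip: power_mult fps_const_mult)

text \<open>The constant term is forced to 0 because the generating function of the Bell polynomials
  starts at \<open>m = 1\<close>; the value \<open>x 0\<close> never enters.\<close>

definition moment_egf :: "(nat \<Rightarrow> real) \<Rightarrow> real fps" where
  "moment_egf x = Abs_fps (\<lambda>m. if m = 0 then 0 else x m / fact m)"

lemma moment_egf_nth: "moment_egf x $ m = (if m = 0 then 0 else x m / fact m)"
  by (simp add: moment_egf_def)

text \<open>The multinomial theorem, applied to the series truncated at degree
  \<open>r - k + 1\<close>, produces the condition that the \<open>j i\<close> sum to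
  \<open>k\<close>; taking the coefficient at \<open>r\<close> produces the condition on the
  weighted sum.\<close>

lemma partial_bell_conv_fps:
  assumes "k \<le> r"
  shows "partial_bell r k x = fact r / fact k * (moment_egf x ^ k) $ r"
proof -
  define N where "N = r - k + 1"
  define a where "a i = fps_const (x i / fact i) * fps_X ^ i" for i
  define J where "J = {j. j \<in> {1..N} \<rightarrow>\<^sub>E UNIV \<and> sum j {1..N} = k}"
  have fin: "finite J"
    unfolding J_def using finite_PiE_sum_eq[of "{1..N}" k] by simp
  have nth: "(\<Sum>i=1..N. a i) $ m = moment_egf x $ m" if "m \<le> N" for m
  proof -
    have "(\<Sum>i=1..N. a i) $ m = (\<Sum>i=1..N. if i = m then x i / fact i else 0)"
      unfolding a_def fps_sum_nth by (intro sum.cong) (auto simp: fps_X_power_nth)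
    then show ?thesis using that by (auto simp: moment_egf_nth)
  qed
  text \<open>Both series have no constant term, so after dividing out \<open>X ^ k\<close> only their coefficients
    up to \<open>r - k + 1\<close> enter.\<close>
  have shift: "(f ^ k) $ r = (fps_shift 1 f ^ k) $ (r - k)" if "f $ 0 = 0" for f :: "real fps"
  proof -
    have "f = fps_X * fps_shift 1 f"
      using that by (intro fps_ext) (auto simp: fps_X_mult_nth)
    then have "f ^ k = fps_X ^ k * fps_shift 1 f ^ k"
      by (metis power_mult_distrib)
    then show ?thesis using assms by (simp add: fps_X_power_mult_nth)
  qed
  have "(moment_egf x ^ k) $ r = ((\<Sum>i=1..N. a i) ^ k) $ r"
  proof -
    have "(fps_shift 1 (moment_egf x) ^ k) $ (r - k) = (fps_shift 1 (\<Sum>i=1..N. a i) ^ k) $ (r - k)"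
    proof (rule fps_power_nth_cong[of "r - k"])
      fix i assume "i \<le> r - k"
      then have "i + 1 \<le> N" by (simp add: N_def)
      then show "fps_shift 1 (moment_egf x) $ i = fps_shift 1 (\<Sum>i=1..N. a i) $ i"
        unfolding fps_shift_nth by (rule nth[symmetric])
    qed simp
    \<comment> \<open>The case \<open>m = 0\<close> of \<open>nth\<close> shows that the truncated
      series also has no constant term, as \<open>shift\<close> demands.\<close>
    then show ?thesis
      using nth[of 0] by (subst (1 2) shift) (auto simp: moment_egf_nth)
  qed
  then have "1 / fact k * (moment_egf x ^ k) $ r = (fps_const (1 / fact k) * (\<Sum>i=1..N. a i) ^ k) $ r"
    by simp
  also have "\<dots> = (\<Sum>j\<in>J. (fps_const (\<Prod>i=1..N. 1 / fact (j i) * (x i / fact i) ^ j i)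
                            * fps_X ^ (\<Sum>i=1..N. i * j i)) $ r)"
    unfolding fps_multinomial[OF finite_atLeastAtMost] a_def J_def fps_prod_const_X_power
    by (simp add: fps_sum_nth)
  \<comment> \<open>A monomial contributes to coefficient \<open>r\<close> exactly when its exponent
    equals \<open>r\<close>.\<close>
  also have "\<dots> = (\<Sum>j\<in>J. if (\<Sum>i=1..N. i * j i) = r
                            then (\<Prod>i=1..N. 1 / fact (j i) * (x i / fact i) ^ j i) else 0)"
    by (intro sum.cong) (auto simp: fps_X_power_nth)
  also have "\<dots> = (\<Sum>j | j \<in> J \<and> (\<Sum>i=1..N. i * j i) = r.
                            (\<Prod>i=1..N. 1 / fact (j i) * (x i / fact i) ^ j i))"
    using fin by (simp add: sum.If_cases Int_def)
  also have "fact r * \<dots> = partial_bell r k x"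
    unfolding partial_bell_def J_def N_def[symmetric] sum_distrib_left
    by (intro sum.cong) (auto simp: prod.distrib prod_dividef)
  finally show ?thesis by simp
qed

text \<open>Every monomial has total degree \<open>k\<close>, the sum of the exponents
  \<open>j i\<close>, so \<open>k\<close> factors \<open>c\<close> come out.\<close>

lemma partial_bell_scale:
  "partial_bell r k (\<lambda>m. c * x m) = c ^ k * partial_bell r k x"
  unfolding partial_bell_def sum_distrib_left
proof (intro sum.cong refl)
  fix j :: "nat \<Rightarrow> nat"
  assume "j \<in> {j \<in> {1..r - k + 1} \<rightarrow>\<^sub>E UNIV.
    (\<Sum>i=1..r - k + 1. j i) = k \<and> (\<Sum>i=1..r - k + 1. i * j i) = r}"
  then have k: "(\<Sum>i=1..r - k + 1. j i) = k" by simp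
  have "(\<Prod>i=1..r - k + 1. (c * x i / fact i) ^ j i) =
        (\<Prod>i=1..r - k + 1. c ^ j i) * (\<Prod>i=1..r - k + 1. (x i / fact i) ^ j i)"
    by (simp only: power_mult_distrib prod.distrib flip: times_divide_eq_right)
  also have "(\<Prod>i=1..r - k + 1. c ^ j i) = c ^ k"
    using k by (simp only: power_sum[symmetric])
  finally show "fact r / (\<Prod>i=1..r - k + 1. fact (j i)) * (\<Prod>i=1..r - k + 1. (c * x i / fact i) ^ j i) =
      c ^ k * (fact r / (\<Prod>i=1..r - k + 1. fact (j i)) * (\<Prod>i=1..r - k + 1. (x i / fact i) ^ j i))"
    by simp
qed

section \<open>Moments through the exponential generating function\<close>

lemma falling_factorial_conv_binomial:
  "falling_factorial n k = fact k * real (n choose k)"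
  by (simp add: falling_factorial_def binomial_gbinomial gbinomial_prod_rev atLeast0LessThan)

lemma fps_exp_prod:
  fixes c :: "'a \<Rightarrow> 'b :: field_char_0"
  shows "(\<Prod>i\<in>A. fps_exp (c i)) = fps_exp (\<Sum>i\<in>A. c i)"
  by (induction A rule: infinite_finite_induct) (auto simp: fps_exp_add_mult)

text \<open>Expanding the \<open>n\<close>-th power gives one exponential for each choice of
  \<open>n\<close> values in \<open>{0..s}\<close>. Its weight and its rate depend only on the sum
  of the values, and \<open>bisnomial\<close> counts the choices with a given sum.\<close>

lemma sum_bisnomial_mass_eq_fps:
  "(\<Sum>k\<le>s * n. bisnomial_mass s n p q k * real k ^ r) =
   fact r * ((\<Sum>l=0..s. fps_const (p ^ l * q ^ (s - l)) * fps_exp (real l)) ^ n) $ r"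
proof -
  define D where "D = {1..n} \<rightarrow>\<^sub>E {0..s}"
  have fin: "finite D" unfolding D_def by (intro finite_PiE) auto
  have weight: "(\<Prod>i=1..n. p ^ x i * q ^ (s - x i)) = p ^ sum x {1..n} * q ^ (s * n - sum x {1..n})"
    and le: "sum x {1..n} \<le> s * n" if "x \<in> D" for x
  proof -
    have x: "x i \<le> s" if "i \<in> {1..n}" for i
      using that \<open>x \<in> D\<close> by (auto simp: D_def PiE_iff)
    then have "sum x {1..n} \<le> (\<Sum>i=1..n. s)" by (intro sum_mono)
    then show "sum x {1..n} \<le> s * n" by (simp add: mult.commute)
    \<comment> \<open>The bound \<open>x i \<le> s\<close> makes the subtraction on natural numbers
      exact.\<close>
    have "(\<Sum>i=1..n. s - x i) = s * n - sum x {1..n}"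
      using x by (subst sum_subtractf_nat) (auto simp: mult.commute)
    then show "(\<Prod>i=1..n. p ^ x i * q ^ (s - x i)) = p ^ sum x {1..n} * q ^ (s * n - sum x {1..n})"
      by (simp add: prod.distrib flip: power_sum)
  qed
  have "((\<Sum>l=0..s. fps_const (p ^ l * q ^ (s - l)) * fps_exp (real l)) ^ n) =
        (\<Prod>i=1..n. \<Sum>l=0..s. fps_const (p ^ l * q ^ (s - l)) * fps_exp (real l))"
    by simp
  also have "\<dots> = (\<Sum>x\<in>D. \<Prod>i=1..n. fps_const (p ^ x i * q ^ (s - x i)) * fps_exp (real (x i)))"
    unfolding D_def by (subst prod_sum_PiE) auto
  also have "\<dots> = (\<Sum>x\<in>D. fps_const (\<Prod>i=1..n. p ^ x i * q ^ (s - x i)) * fps_exp (real (sum x {1..n})))"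
  proof (intro sum.cong refl)
    fix x :: "nat \<Rightarrow> nat"
    have "(\<Prod>i\<in>A. fps_const (c i)) = fps_const (prod c A)" for A :: "nat set" and c :: "nat \<Rightarrow> real"
      by (induction A rule: infinite_finite_induct) auto
    then show "(\<Prod>i=1..n. fps_const (p ^ x i * q ^ (s - x i)) * fps_exp (real (x i))) =
      fps_const (\<Prod>i=1..n. p ^ x i * q ^ (s - x i)) * fps_exp (real (sum x {1..n}))"
      by (simp only: prod.distrib fps_exp_prod of_nat_sum)
  qed
  \<comment> \<open>Coefficient \<open>r\<close> of \<open>fps_exp c\<close> is
    \<open>c ^ r / fact r\<close>, so the factorial cancels.\<close>
  finally have "fact r * ((\<Sum>l=0..s. fps_const (p ^ l * q ^ (s - l)) * fps_exp (real l)) ^ n) $ r =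
        (\<Sum>x\<in>D. (\<Prod>i=1..n. p ^ x i * q ^ (s - x i)) * real (sum x {1..n}) ^ r)"
    by (simp add: fps_sum_nth sum_distrib_left del: of_nat_sum)
  also have "\<dots> = (\<Sum>x\<in>D. p ^ sum x {1..n} * q ^ (s * n - sum x {1..n}) * real (sum x {1..n}) ^ r)"
    by (intro sum.cong) (simp_all only: weight)
  \<comment> \<open>By \<open>le\<close>, the fibres over \<open>k \<le> s * n\<close> exhaust
    \<open>D\<close>.\<close>
  also have "\<dots> = (\<Sum>k\<le>s * n. \<Sum>x | x \<in> D \<and> sum x {1..n} = k.
                p ^ sum x {1..n} * q ^ (s * n - sum x {1..n}) * real (sum x {1..n}) ^ r)"
    using fin le by (subst sum.group) auto
  also have "\<dots> = (\<Sum>k\<le>s * n. \<Sum>x | x \<in> D \<and> sum x {1..n} = k. p ^ k * q ^ (s * n - k) * real k ^ r)"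
    by (intro sum.cong) auto
  also have "\<dots> = (\<Sum>k\<le>s * n. bisnomial_mass s n p q k * real k ^ r)"
    by (intro sum.cong) (auto simp: bisnomial_mass_def bisnomial_def D_def)
  finally show ?thesis ..
qed

text \<open>The constant coefficient is the total weight 1. In higher coefficients the term
  \<open>l = 0\<close> vanishes because \<open>0 ^ m = 0\<close> for positive \<open>m\<close>, so
  the sum may start at 1.\<close>

lemma one_plus_moment_egf:
  assumes "(\<Sum>l=0..s. p ^ l * q ^ (s - l)) = 1"
  shows "(\<Sum>l=0..s. fps_const (p ^ l * q ^ (s - l)) * fps_exp (real l)) =
         1 + moment_egf (\<lambda>m. \<Sum>l=1..s. real l ^ m * p ^ l * q ^ (s - l))"
proof (rule fps_ext)
  fix m
  show "(\<Sum>l=0..s. fps_const (p ^ l * q ^ (s - l)) * fps_exp (real l)) $ m =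
    (1 + moment_egf (\<lambda>m. \<Sum>l=1..s. real l ^ m * p ^ l * q ^ (s - l))) $ m"
  proof (cases "m = 0")
    case True
    then show ?thesis using assms by (simp add: fps_sum_nth moment_egf_nth)
  next
    case False
    have "(\<Sum>l=0..s. p ^ l * q ^ (s - l) * (real l ^ m / fact m)) =
          (\<Sum>l=1..s. p ^ l * q ^ (s - l) * (real l ^ m / fact m))"
      using False by (subst sum.atLeast_Suc_atMost) auto
    then show ?thesis using False
      by (simp add: fps_sum_nth moment_egf_nth sum_divide_distrib mult_ac)
  qed
qed

text \<open>Binomial expansion: the factor \<open>fact k\<close> in the falling factorial cancels
  the \<open>1 / fact k\<close> in the coefficient formula for the Bell polynomial.\<close>

lemma fps_power_one_plus_moment_egf_nth:
  assumes "r \<ge> 1"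
  shows "fact r * ((1 + moment_egf x) ^ n) $ r =
         (\<Sum>k=1..r. falling_factorial n k * partial_bell r k x)"
proof -
  define c where "c k = fact r * real (n choose k) * (moment_egf x ^ k) $ r" for k
  \<comment> \<open>This lets the range \<open>k \<le> n\<close> be exchanged for
    \<open>1..r\<close>: the power with \<open>k = 0\<close> is constant while
    \<open>r \<ge> 1\<close>, the power with \<open>k > r\<close> starts beyond degree
    \<open>r\<close>, and \<open>n choose k\<close> is 0 for \<open>k > n\<close>.\<close>
  have zero: "c k = 0" if "k = 0 \<or> k > r \<or> k > n" for k
  proof -
    have "(moment_egf x ^ k) $ r = 0" if "k > r"
      using that by (intro startsby_zero_power_prefix[rule_format]) (auto simp: moment_egf_nth)
    then show ?thesis using that assms by (auto simp: c_def)
  qed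
  have "(1 + moment_egf x) ^ n = (\<Sum>k\<le>n. of_nat (n choose k) * moment_egf x ^ k)"
    by (subst add.commute) (simp add: binomial_ring)
  then have "fact r * ((1 + moment_egf x) ^ n) $ r = (\<Sum>k\<le>n. c k)"
    by (simp add: fps_sum_nth sum_distrib_left c_def mult.assoc flip: fps_of_nat)
  also have "\<dots> = (\<Sum>k=1..r. c k)"
    by (intro sum.mono_neutral_cong) (auto intro!: zero)
  also have "\<dots> = (\<Sum>k=1..r. falling_factorial n k * partial_bell r k x)"
    by (intro sum.cong)
      (auto simp: c_def partial_bell_conv_fps falling_factorial_conv_binomial)
  finally show ?thesis .
qed

theorem theorem4p2:
  fixes s n r :: nat and p q :: real
    and M :: "'a measure" and X :: "'a \<Rightarrow> nat"
  assumes "s \<ge> 1" and "n \<ge> 1" and "r \<ge> 1"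
    and "0 < p" and "p < 1" and "0 < q" and "q < 1"
    and "(\<Sum>k=0..s. p ^ k * q ^ (s - k)) = 1"
    and "prob_space M"
    and "distributed M (count_space UNIV) X (\<lambda>k. ennreal (bisnomial_mass s n p q k))"
  shows "(p \<noteq> q \<longrightarrow>
            prob_space.expectation M (\<lambda>\<omega>. real (X \<omega>) ^ r) =
              (\<Sum>k=1..r. falling_factorial n k *
                 partial_bell r k (\<lambda>m. \<Sum>l=1..s. real l ^ m * p ^ l * q ^ (s - l)))) \<and>
         (p = q \<longrightarrow>
            prob_space.expectation M (\<lambda>\<omega>. real (X \<omega>) ^ r) =
              (\<Sum>k=1..r. falling_factorial n k * p ^ (k * s) *
                 partial_bell r k (\<lambda>m. \<Sum>l=1..s. real l ^ m)))"
proof -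
  have "(\<integral>\<omega>. real (X \<omega>) ^ r \<partial>M) = (\<integral>k. bisnomial_mass s n p q k * real k ^ r \<partial>count_space UNIV)"
    using assms by (intro distributed_integral[symmetric]) (auto simp: bisnomial_mass_def)
  \<comment> \<open>The mass is 0 beyond \<open>s * n\<close>, so the integral over the counting
    measure is a finite sum.\<close>
  also have "\<dots> = (\<Sum>k | k \<in> UNIV \<and> bisnomial_mass s n p q k * real k ^ r \<noteq> 0.
                     bisnomial_mass s n p q k * real k ^ r)"
    by (rule lebesgue_integral_count_space_finite_support, rule finite_subset[of _ "{..s * n}"])
      (auto simp: bisnomial_mass_def split: if_splits)
  also have "\<dots> = (\<Sum>k\<le>s * n. bisnomial_mass s n p q k * real k ^ r)"
    by (intro sum.mono_neutral_left) (auto simp: bisnomial_mass_def split: if_splits)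
  also have "\<dots> = (\<Sum>k=1..r. falling_factorial n k *
                 partial_bell r k (\<lambda>m. \<Sum>l=1..s. real l ^ m * p ^ l * q ^ (s - l)))"
    unfolding sum_bisnomial_mass_eq_fps one_plus_moment_egf[OF assms(8)]
    by (rule fps_power_one_plus_moment_egf_nth) fact
  finally have main: "(\<integral>\<omega>. real (X \<omega>) ^ r \<partial>M) = (\<Sum>k=1..r. falling_factorial n k *
                 partial_bell r k (\<lambda>m. \<Sum>l=1..s. real l ^ m * p ^ l * q ^ (s - l)))" .
  \<comment> \<open>For \<open>p = q\<close> every weight equals \<open>p ^ s\<close>; homogeneity
    with \<open>c = p ^ s\<close> then yields the factor \<open>p ^ (k * s)\<close>.\<close>
  have "(\<Sum>l=1..s. real l ^ m * p ^ l * p ^ (s - l)) = p ^ s * (\<Sum>l=1..s. real l ^ m)" for m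
    unfolding sum_distrib_left by (intro sum.cong) (auto simp: mult.assoc simp flip: power_add)
  then have "partial_bell r k (\<lambda>m. \<Sum>l=1..s. real l ^ m * p ^ l * p ^ (s - l)) =
             p ^ (k * s) * partial_bell r k (\<lambda>m. \<Sum>l=1..s. real l ^ m)" for k
    by (simp only: partial_bell_scale mult.commute[of k s] power_mult)
  with main show ?thesis by (auto simp: mult.assoc)
qed

end
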